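(* Let $R$ be a ring and $M$ a right $R$-module. (i) The following are equivalent: (a) $M$ is Baer. (b) For every nonempty set $\Lambda$, every $R$-homomorphism $f: M\rightarrow M^{\Lambda}$ and every direct summand $D$ of $M^{\Lambda}$, the inverse image $f^{-1}(D)$ is a direct summand of $M$. (c) For every nonempty set $\Lambda$ and every $R$-homomorphism $f: M\rightarrow M^{\Lambda}$, $\ker f$ is a direct summand of $M$. (d) For every submodule $N\leq M$, $\mathrm{Rej}^{-1}(N)$ is a direct summand of $M$. (ii) The following are equivalent: (a) $M$ is dual Baer. (b) For every nonempty set $\Lambda$, every $R$-homomorphism $f: M^{(\Lambda)}\rightarrow M$ preserves direct summands (i.e. $f(D)$ is a direct summand of $M$ for every direct summand $D$ of $M^{(\Lambda)}$). (c) For every nonempty set $\Lambda$ and every $R$-homomorphism $f: M^{(\Lambda)}\rightarrow M$, $\mathrm{Im}\, f$ is a direct summand of $M$. (d) For every submodule $N\leq M$, $\mathrm{Tr}(M,N)$ is a direct summand of $M$.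
   Context: Rings have a unit element and modules are right unitary modules. Let $S=\mathrm{End}_R(M)$. $M$ is Baer if for every non-empty subset $X\subseteq S$ the submodule $\bigcap_{f\in X}\ker f$ is a direct summand of $M$. $M$ is dual Baer if for every submodule $N\leq M$ the right ideal $\mathrm{Hom}_R(M,N)$ of $S$ equals $eS$ for some $e=e^2\in S$. $M^{\Lambda}$ and $M^{(\Lambda)}$ denote the direct product and direct sum of $\Lambda$ copies of $M$. For $R$-modules $K,L$: $\mathrm{Tr}(K,L)=\sum\{f(K) : f\in \mathrm{Hom}_R(K,L)\}$ and $\mathrm{Rej}(K,L)=\bigcap\{\ker f: f\in\mathrm{Hom}_R(K,L)\}$. For $N\leq M$ with canonical epimorphism $\pi: M\rightarrow M/N$, $\mathrm{Rej}^{-1}(N)=\pi^{-1}(\mathrm{Rej}(M/N,M))$. *)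

theory Defs
  imports "HOL-Algebra.Module" "HOL-Algebra.AbelCoset"
begin

text \<open>
  Modules are represented by the record type of \<^theory>\<open>HOL-Algebra.Module\<close>. The library locale
  \<^locale>\<open>module\<close> requires a commutative ring of scalars, so right modules over an arbitrary
  unital ring are introduced here. The term \<open>a \<odot>\<^bsub>M\<^esub> x\<close> stands for \<open>x a\<close>; only the associativity
  law \<open>x (a b) = (x a) b\<close> distinguishes right from left modules. As in the library, the ring
  multiplication and unit of the record \<open>M\<close> play no role. The library locale \<^locale>\<open>submodule\<close>
  only demands closure, hence also applies to right modules.
\<close>

locale right_module = R?: ring R + M?: abelian_group M
  for R :: "('r, 'x) ring_scheme" (structure) and M :: "('r, 'm, 'y) module_scheme" (structure) +
  assumes smult_closed [simp, intro]:
      "\<lbrakk>a \<in> carrier R; x \<in> carrier M\<rbrakk> \<Longrightarrow> a \<odot>\<^bsub>M\<^esub> x \<in> carrier M"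
    and smult_l_distr:
      "\<lbrakk>a \<in> carrier R; b \<in> carrier R; x \<in> carrier M\<rbrakk> \<Longrightarrow>
      (a \<oplus> b) \<odot>\<^bsub>M\<^esub> x = a \<odot>\<^bsub>M\<^esub> x \<oplus>\<^bsub>M\<^esub> b \<odot>\<^bsub>M\<^esub> x"
    and smult_r_distr:
      "\<lbrakk>a \<in> carrier R; x \<in> carrier M; y \<in> carrier M\<rbrakk> \<Longrightarrow>
      a \<odot>\<^bsub>M\<^esub> (x \<oplus>\<^bsub>M\<^esub> y) = a \<odot>\<^bsub>M\<^esub> x \<oplus>\<^bsub>M\<^esub> a \<odot>\<^bsub>M\<^esub> y"
    and smult_assoc:
      "\<lbrakk>a \<in> carrier R; b \<in> carrier R; x \<in> carrier M\<rbrakk> \<Longrightarrow>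
      (a \<otimes> b) \<odot>\<^bsub>M\<^esub> x = b \<odot>\<^bsub>M\<^esub> (a \<odot>\<^bsub>M\<^esub> x)"
    and smult_one [simp]:
      "x \<in> carrier M \<Longrightarrow> \<one> \<odot>\<^bsub>M\<^esub> x = x"

definition direct_summand ::
    "('r, 'x) ring_scheme \<Rightarrow> ('r, 'm, 'y) module_scheme \<Rightarrow> 'm set \<Rightarrow> bool" where
  "direct_summand R M D \<longleftrightarrow> submodule D R M \<and>
     (\<exists>E. submodule E R M \<and> D \<inter> E = {\<zero>\<^bsub>M\<^esub>} \<and> D <+>\<^bsub>M\<^esub> E = carrier M)"

text \<open>
  Homomorphisms are extensional (\<^const>\<open>undefined\<close> outside the carrier), so that equality of
  homomorphisms is equality of HOL functions. In particular, for a submodule \<open>N\<close> of \<open>M\<close>, the set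
  \<open>Hom R M (M\<lparr>carrier := N\<rparr>)\<close> is literally a subset of the endomorphism ring of \<open>M\<close>.
\<close>

definition Hom ::
    "('r, 'x) ring_scheme \<Rightarrow> ('r, 'k, 'y) module_scheme \<Rightarrow> ('r, 'l, 'z) module_scheme
      \<Rightarrow> ('k \<Rightarrow> 'l) set" where
  "Hom R K L = {f \<in> carrier K \<rightarrow>\<^sub>E carrier L.
     (\<forall>x\<in>carrier K. \<forall>y\<in>carrier K. f (x \<oplus>\<^bsub>K\<^esub> y) = f x \<oplus>\<^bsub>L\<^esub> f y) \<and>
     (\<forall>a\<in>carrier R. \<forall>x\<in>carrier K. f (a \<odot>\<^bsub>K\<^esub> x) = a \<odot>\<^bsub>L\<^esub> f x)}"

definition End_ring ::
    "('r, 'x) ring_scheme \<Rightarrow> ('r, 'm, 'y) module_scheme \<Rightarrow> ('m \<Rightarrow> 'm) ring" where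
  "End_ring R M =
    \<lparr>carrier = Hom R M M,
     mult = compose (carrier M),
     one = (\<lambda>x\<in>carrier M. x),
     zero = (\<lambda>x\<in>carrier M. \<zero>\<^bsub>M\<^esub>),
     add = (\<lambda>f g. \<lambda>x\<in>carrier M. f x \<oplus>\<^bsub>M\<^esub> g x)\<rparr>"

definition Baer :: "('r, 'x) ring_scheme \<Rightarrow> ('r, 'm, 'y) module_scheme \<Rightarrow> bool" where
  "Baer R M \<longleftrightarrow> (\<forall>X. X \<subseteq> carrier (End_ring R M) \<and> X \<noteq> {} \<longrightarrow>
     direct_summand R M (\<Inter>f\<in>X. a_kernel M M f))"

definition dual_Baer :: "('r, 'x) ring_scheme \<Rightarrow> ('r, 'm, 'y) module_scheme \<Rightarrow> bool" where
  "dual_Baer R M \<longleftrightarrow> (\<forall>N. submodule N R M \<longrightarrow>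
     (\<exists>e\<in>carrier (End_ring R M). e = e \<otimes>\<^bsub>End_ring R M\<^esub> e \<and>
        Hom R M (M\<lparr>carrier := N\<rparr>) = e <#\<^bsub>End_ring R M\<^esub> carrier (End_ring R M)))"

definition direct_power :: "('r, 'm, 'y) module_scheme \<Rightarrow> 'i set \<Rightarrow> ('r, 'i \<Rightarrow> 'm) module" where
  "direct_power M \<Lambda> =
    \<lparr>carrier = \<Lambda> \<rightarrow>\<^sub>E carrier M,
     mult = undefined,
     one = undefined,
     zero = (\<lambda>i\<in>\<Lambda>. \<zero>\<^bsub>M\<^esub>),
     add = (\<lambda>x y. \<lambda>i\<in>\<Lambda>. x i \<oplus>\<^bsub>M\<^esub> y i),
     smult = (\<lambda>a x. \<lambda>i\<in>\<Lambda>. a \<odot>\<^bsub>M\<^esub> x i)\<rparr>"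

definition direct_copower :: "('r, 'm, 'y) module_scheme \<Rightarrow> 'i set \<Rightarrow> ('r, 'i \<Rightarrow> 'm) module" where
  "direct_copower M \<Lambda> =
    (direct_power M \<Lambda>)\<lparr>carrier := {x \<in> \<Lambda> \<rightarrow>\<^sub>E carrier M. finite {i \<in> \<Lambda>. x i \<noteq> \<zero>\<^bsub>M\<^esub>}}\<rparr>"

definition quotient_module ::
    "('r, 'm, 'y) module_scheme \<Rightarrow> 'm set \<Rightarrow> ('r, 'm set) module" where
  "quotient_module M N =
    \<lparr>carrier = a_rcosets\<^bsub>M\<^esub> N,
     mult = undefined,
     one = undefined,
     zero = N,
     add = set_add M,
     smult = (\<lambda>a X. \<Union>x\<in>X. N +>\<^bsub>M\<^esub> (a \<odot>\<^bsub>M\<^esub> x))\<rparr>"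

definition sum_of_submodules :: "('r, 'm, 'y) module_scheme \<Rightarrow> 'm set set \<Rightarrow> 'm set" where
  "sum_of_submodules M \<N> =
    {finsum M g F | g F. finite F \<and> F \<subseteq> \<N> \<and> (\<forall>N\<in>F. g N \<in> N)}"

definition Tr ::
    "('r, 'x) ring_scheme \<Rightarrow> ('r, 'k, 'y) module_scheme \<Rightarrow> ('r, 'l, 'z) module_scheme
      \<Rightarrow> 'l set" where
  "Tr R K L = sum_of_submodules L {f ` carrier K | f. f \<in> Hom R K L}"

definition Rej ::
    "('r, 'x) ring_scheme \<Rightarrow> ('r, 'k, 'y) module_scheme \<Rightarrow> ('r, 'l, 'z) module_scheme
      \<Rightarrow> 'k set" where
  "Rej R K L = (\<Inter>f\<in>Hom R K L. a_kernel K L f)"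

definition Rej_inv ::
    "('r, 'x) ring_scheme \<Rightarrow> ('r, 'm, 'y) module_scheme \<Rightarrow> 'm set \<Rightarrow> 'm set" where
  "Rej_inv R M N = {x \<in> carrier M. N +>\<^bsub>M\<^esub> x \<in> Rej R (quotient_module M N) M}"

text \<open>
  The remaining predicates are conditions on a single index set \<open>\<Lambda>\<close>. HOL cannot quantify over
  the index sets of all types inside a formula. A condition that is to hold for all
  nonempty index sets is therefore used in two forms: for all nonempty \<open>\<Lambda> :: ('m \<Rightarrow> 'm) set\<close>,
  where \<open>'m\<close> is the element type of \<open>M\<close>, and for all nonempty \<open>\<Lambda> :: 'i set\<close> with \<open>'i\<close> an
  arbitrary type. The former type contains the endomorphism ring of \<open>M\<close> and all its subsets as
  index sets. The first form is an equivalent of the (dual) Baer property, and the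
  second form is a consequence of it.
\<close>

definition preimages_of_summands ::
    "('r, 'x) ring_scheme \<Rightarrow> ('r, 'm, 'y) module_scheme \<Rightarrow> 'i set \<Rightarrow> bool" where
  "preimages_of_summands R M \<Lambda> \<longleftrightarrow>
    (\<forall>f\<in>Hom R M (direct_power M \<Lambda>). \<forall>D. direct_summand R (direct_power M \<Lambda>) D \<longrightarrow>
       direct_summand R M {x \<in> carrier M. f x \<in> D})"

definition kernels_are_summands ::
    "('r, 'x) ring_scheme \<Rightarrow> ('r, 'm, 'y) module_scheme \<Rightarrow> 'i set \<Rightarrow> bool" where
  "kernels_are_summands R M \<Lambda> \<longleftrightarrow>
    (\<forall>f\<in>Hom R M (direct_power M \<Lambda>).
       direct_summand R M (a_kernel M (direct_power M \<Lambda>) f))"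

definition images_of_summands ::
    "('r, 'x) ring_scheme \<Rightarrow> ('r, 'm, 'y) module_scheme \<Rightarrow> 'i set \<Rightarrow> bool" where
  "images_of_summands R M \<Lambda> \<longleftrightarrow>
    (\<forall>f\<in>Hom R (direct_copower M \<Lambda>) M. \<forall>D. direct_summand R (direct_copower M \<Lambda>) D \<longrightarrow>
       direct_summand R M (f ` D))"

definition images_are_summands ::
    "('r, 'x) ring_scheme \<Rightarrow> ('r, 'm, 'y) module_scheme \<Rightarrow> 'i set \<Rightarrow> bool" where
  "images_are_summands R M \<Lambda> \<longleftrightarrow>
    (\<forall>f\<in>Hom R (direct_copower M \<Lambda>) M.
       direct_summand R M (f ` carrier (direct_copower M \<Lambda>)))"

end

theory Submission
  imports Defs
begin

text \<open>
  A submodule \<open>D\<close> is a direct summand iff it admits a retraction in \<open>Hom R M M\<close>, and a direct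
  summand is always the kernel of an endomorphism. Hence a preimage of a summand is itself a kernel
  and an image of a summand is itself an image of a full copower.

  A homomorphism into a power is the same as a family of endomorphisms, so its kernels are
  exactly the intersections in the definition of a Baer module; and \<open>Rej_inv R M N\<close> is the
  intersection of the kernels of all endomorphisms vanishing on \<open>N\<close>, which is \<open>N\<close> itself
  when \<open>N\<close> is such an intersection.

  Dually, \<open>Hom R M N = e S\<close> with \<open>e\<close> idempotent means that \<open>e M\<close> is a direct summand contained
  in \<open>N\<close> which contains the images of all endomorphisms with values in \<open>N\<close>. Such a summand equals
  \<open>Tr R M N\<close>, and it equals \<open>N\<close> when \<open>N\<close> is the image of a copower.
\<close>

subsection \<open>Homomorphisms and submodules of right modules\<close>


lemma Hom_closed: "f \<in> Hom R K L \<Longrightarrow> x \<in> carrier K \<Longrightarrow> f x \<in> carrier L"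
  and Hom_add: "f \<in> Hom R K L \<Longrightarrow> x \<in> carrier K \<Longrightarrow> y \<in> carrier K
    \<Longrightarrow> f (x \<oplus>\<^bsub>K\<^esub> y) = f x \<oplus>\<^bsub>L\<^esub> f y"
  and Hom_smult: "f \<in> Hom R K L \<Longrightarrow> a \<in> carrier R \<Longrightarrow> x \<in> carrier K
    \<Longrightarrow> f (a \<odot>\<^bsub>K\<^esub> x) = a \<odot>\<^bsub>L\<^esub> f x"
  and Hom_extensional: "f \<in> Hom R K L \<Longrightarrow> f \<in> extensional (carrier K)"
  unfolding Hom_def by (auto simp: PiE_def)

lemma HomI:
  assumes "\<And>x. x \<in> carrier K \<Longrightarrow> f x \<in> carrier L"
    and "\<And>x y. x \<in> carrier K \<Longrightarrow> y \<in> carrier K \<Longrightarrow> f (x \<oplus>\<^bsub>K\<^esub> y) = f x \<oplus>\<^bsub>L\<^esub> f y"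
    and "\<And>a x. a \<in> carrier R \<Longrightarrow> x \<in> carrier K \<Longrightarrow> f (a \<odot>\<^bsub>K\<^esub> x) = a \<odot>\<^bsub>L\<^esub> f x"
    and "f \<in> extensional (carrier K)"
  shows "f \<in> Hom R K L"
  using assms unfolding Hom_def by (auto simp: PiE_def)

text \<open>Updating the carrier leaves the addition and the scalar action of \<open>L\<close>
  untouched, and extensionality concerns only the domain. Membership in Hom(M,N) can therefore be
  traded for a condition on endomorphisms without any coercion.\<close>

lemma Hom_carrier_update:
  assumes "N \<subseteq> carrier L"
  shows "f \<in> Hom R K (L\<lparr>carrier := N\<rparr>) \<longleftrightarrow> f \<in> Hom R K L \<and> (\<forall>x\<in>carrier K. f x \<in> N)"
  using assms unfolding Hom_def by (auto simp: PiE_def)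

lemma submoduleD:
  assumes "submodule N R M"
  shows "N \<subseteq> carrier M" and "\<zero>\<^bsub>M\<^esub> \<in> N"
    and "x \<in> N \<Longrightarrow> y \<in> N \<Longrightarrow> x \<oplus>\<^bsub>M\<^esub> y \<in> N"
    and "x \<in> N \<Longrightarrow> \<ominus>\<^bsub>M\<^esub> x \<in> N"
    and "a \<in> carrier R \<Longrightarrow> x \<in> N \<Longrightarrow> a \<odot>\<^bsub>M\<^esub> x \<in> N"
proof -
  interpret submodule N R M by fact
  show "N \<subseteq> carrier M" "\<zero>\<^bsub>M\<^esub> \<in> N"
    "x \<in> N \<Longrightarrow> y \<in> N \<Longrightarrow> x \<oplus>\<^bsub>M\<^esub> y \<in> N" "x \<in> N \<Longrightarrow> \<ominus>\<^bsub>M\<^esub> x \<in> N"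
    "a \<in> carrier R \<Longrightarrow> x \<in> N \<Longrightarrow> a \<odot>\<^bsub>M\<^esub> x \<in> N"
    using subset one_closed m_closed m_inv_closed smult_closed by (auto simp: a_inv_def)
qed

lemma right_moduleI:
  assumes "ring R"
    and "\<And>x y. x \<in> carrier M \<Longrightarrow> y \<in> carrier M \<Longrightarrow> x \<oplus>\<^bsub>M\<^esub> y \<in> carrier M"
    and "\<zero>\<^bsub>M\<^esub> \<in> carrier M"
    and "\<And>x y z. x \<in> carrier M \<Longrightarrow> y \<in> carrier M \<Longrightarrow> z \<in> carrier M
      \<Longrightarrow> (x \<oplus>\<^bsub>M\<^esub> y) \<oplus>\<^bsub>M\<^esub> z = x \<oplus>\<^bsub>M\<^esub> (y \<oplus>\<^bsub>M\<^esub> z)"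
    and "\<And>x y. x \<in> carrier M \<Longrightarrow> y \<in> carrier M \<Longrightarrow> x \<oplus>\<^bsub>M\<^esub> y = y \<oplus>\<^bsub>M\<^esub> x"
    and "\<And>x. x \<in> carrier M \<Longrightarrow> \<zero>\<^bsub>M\<^esub> \<oplus>\<^bsub>M\<^esub> x = x"
    and "\<And>x. x \<in> carrier M \<Longrightarrow> \<exists>y\<in>carrier M. y \<oplus>\<^bsub>M\<^esub> x = \<zero>\<^bsub>M\<^esub>"
    and "right_module_axioms R M"
  shows "right_module R M"
  using assms by (intro right_module.intro abelian_groupI) auto

context right_module
begin

lemma smult_l_null:
  assumes "x \<in> carrier M"
  shows "\<zero> \<odot>\<^bsub>M\<^esub> x = \<zero>\<^bsub>M\<^esub>"
proof -
  have "\<zero> \<odot>\<^bsub>M\<^esub> x \<oplus>\<^bsub>M\<^esub> \<zero> \<odot>\<^bsub>M\<^esub> x = \<zero> \<odot>\<^bsub>M\<^esub> x"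
    using smult_l_distr[of \<zero> \<zero> x] assms by simp
  then show ?thesis
    using assms by (metis M.add.r_cancel_one' R.zero_closed smult_closed)
qed

lemma smult_r_null:
  assumes "a \<in> carrier R"
  shows "a \<odot>\<^bsub>M\<^esub> \<zero>\<^bsub>M\<^esub> = \<zero>\<^bsub>M\<^esub>"
proof -
  have "a \<odot>\<^bsub>M\<^esub> \<zero>\<^bsub>M\<^esub> \<oplus>\<^bsub>M\<^esub> a \<odot>\<^bsub>M\<^esub> \<zero>\<^bsub>M\<^esub> = a \<odot>\<^bsub>M\<^esub> \<zero>\<^bsub>M\<^esub>"
    using smult_r_distr[of a "\<zero>\<^bsub>M\<^esub>" "\<zero>\<^bsub>M\<^esub>"] assms by simp
  then show ?thesis
    using assms by (metis M.add.r_cancel_one' M.zero_closed smult_closed)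
qed

lemma smult_minus_one:
  assumes "x \<in> carrier M"
  shows "(\<ominus> \<one>) \<odot>\<^bsub>M\<^esub> x = \<ominus>\<^bsub>M\<^esub> x"
proof -
  have "(\<ominus> \<one>) \<odot>\<^bsub>M\<^esub> x \<oplus>\<^bsub>M\<^esub> x = \<zero>\<^bsub>M\<^esub>"
    using smult_l_distr[of "\<ominus> \<one>" \<one> x] assms by (simp add: R.l_neg smult_l_null)
  then show ?thesis
    using assms M.minus_equality by simp
qed

text \<open>Since the scalars have a unit, the negative of x is the action of -1 on x, so closure
  under negation follows from closure under scalars.\<close>

lemma submoduleI:
  assumes "N \<subseteq> carrier M" and "\<zero>\<^bsub>M\<^esub> \<in> N"
    and "\<And>x y. x \<in> N \<Longrightarrow> y \<in> N \<Longrightarrow> x \<oplus>\<^bsub>M\<^esub> y \<in> N"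
    and smult: "\<And>a x. a \<in> carrier R \<Longrightarrow> x \<in> N \<Longrightarrow> a \<odot>\<^bsub>M\<^esub> x \<in> N"
  shows "submodule N R M"
proof -
  have "\<ominus>\<^bsub>M\<^esub> x \<in> N" if "x \<in> N" for x
    using smult[of "\<ominus> \<one>" x] smult_minus_one[of x] that assms(1) by auto
  then show ?thesis
    using assms by (auto intro!: submodule.intro subgroup.intro submodule_axioms.intro simp: a_inv_def)
qed

lemma submodule_carrier: "submodule (carrier M) R M"
  by (rule submoduleI) auto

lemma right_module_submodule:
  assumes "submodule N R M"
  shows "right_module R (M\<lparr>carrier := N\<rparr>)"
proof -
  note N = submoduleD[OF assms]
  have sub: "x \<in> carrier M" if "x \<in> N" for x
    using N(1) that by blast
  show ?thesis
  proof (rule right_moduleI)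
    show "right_module_axioms R (M\<lparr>carrier := N\<rparr>)"
      by unfold_locales (use N(5) in \<open>auto simp: sub smult_l_distr smult_r_distr smult_assoc\<close>)
    show "\<exists>y\<in>carrier (M\<lparr>carrier := N\<rparr>). y \<oplus>\<^bsub>M\<lparr>carrier := N\<rparr>\<^esub> x = \<zero>\<^bsub>M\<lparr>carrier := N\<rparr>\<^esub>"
      if "x \<in> carrier (M\<lparr>carrier := N\<rparr>)" for x
      using that N(4)[of x] sub M.l_neg by auto
    show "x \<oplus>\<^bsub>M\<lparr>carrier := N\<rparr>\<^esub> y = y \<oplus>\<^bsub>M\<lparr>carrier := N\<rparr>\<^esub> x"
      if "x \<in> carrier (M\<lparr>carrier := N\<rparr>)" "y \<in> carrier (M\<lparr>carrier := N\<rparr>)" for x y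
      using that sub M.a_comm by simp
  qed (use N R.ring_axioms in \<open>auto simp: sub M.a_assoc\<close>)
qed

section \<open>Powers and copowers as right modules\<close>

lemma right_module_direct_power: "right_module R (direct_power M \<Lambda>)"
proof (rule right_moduleI)
  show "right_module_axioms R (direct_power M \<Lambda>)"
    by unfold_locales
      (auto simp: direct_power_def PiE_iff smult_l_distr smult_r_distr smult_assoc fun_eq_iff
         extensional_def)
  show "\<exists>y\<in>carrier (direct_power M \<Lambda>). y \<oplus>\<^bsub>direct_power M \<Lambda>\<^esub> x = \<zero>\<^bsub>direct_power M \<Lambda>\<^esub>"
    if "x \<in> carrier (direct_power M \<Lambda>)" for x
    using that by (intro bexI[of _ "\<lambda>i\<in>\<Lambda>. \<ominus>\<^bsub>M\<^esub> x i"])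
      (auto simp: direct_power_def PiE_iff M.l_neg fun_eq_iff)
  show "x \<oplus>\<^bsub>direct_power M \<Lambda>\<^esub> y = y \<oplus>\<^bsub>direct_power M \<Lambda>\<^esub> x"
    if "x \<in> carrier (direct_power M \<Lambda>)" "y \<in> carrier (direct_power M \<Lambda>)" for x y
    using that by (auto simp: direct_power_def PiE_iff fun_eq_iff intro: M.a_comm)
qed (use R.ring_axioms in \<open>auto simp: direct_power_def PiE_iff fun_eq_iff extensional_def
       M.a_assoc\<close>)

text \<open>The support of a sum lies in the union of the two supports, and scalars do not enlarge
  supports. The module laws of the copower are then inherited from the power.\<close>

lemma submodule_direct_copower:
  "submodule (carrier (direct_copower M \<Lambda>)) R (direct_power M \<Lambda>)"
proof -
  interpret P: right_module R "direct_power M \<Lambda>" by (rule right_module_direct_power)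
  show ?thesis
  proof (rule P.submoduleI)
    fix x y assume xy: "x \<in> carrier (direct_copower M \<Lambda>)" "y \<in> carrier (direct_copower M \<Lambda>)"
    have "{i \<in> \<Lambda>. x i \<oplus>\<^bsub>M\<^esub> y i \<noteq> \<zero>\<^bsub>M\<^esub>} \<subseteq> {i \<in> \<Lambda>. x i \<noteq> \<zero>\<^bsub>M\<^esub>} \<union> {i \<in> \<Lambda>. y i \<noteq> \<zero>\<^bsub>M\<^esub>}"
      by auto
    then have "finite {i \<in> \<Lambda>. x i \<oplus>\<^bsub>M\<^esub> y i \<noteq> \<zero>\<^bsub>M\<^esub>}"
      using xy by (auto simp: direct_copower_def intro: finite_subset)
    then show "x \<oplus>\<^bsub>direct_power M \<Lambda>\<^esub> y \<in> carrier (direct_copower M \<Lambda>)"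
      using xy by (auto simp: direct_copower_def direct_power_def PiE_iff cong: conj_cong)
  next
    fix a x assume ax: "a \<in> carrier R" "x \<in> carrier (direct_copower M \<Lambda>)"
    then have "{i \<in> \<Lambda>. a \<odot>\<^bsub>M\<^esub> x i \<noteq> \<zero>\<^bsub>M\<^esub>} \<subseteq> {i \<in> \<Lambda>. x i \<noteq> \<zero>\<^bsub>M\<^esub>}"
      by (auto simp: smult_r_null)
    then have "finite {i \<in> \<Lambda>. a \<odot>\<^bsub>M\<^esub> x i \<noteq> \<zero>\<^bsub>M\<^esub>}"
      using ax by (auto simp: direct_copower_def intro: finite_subset)
    then show "a \<odot>\<^bsub>direct_power M \<Lambda>\<^esub> x \<in> carrier (direct_copower M \<Lambda>)"
      using ax by (auto simp: direct_copower_def direct_power_def PiE_iff cong: conj_cong)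
  qed (auto simp: direct_copower_def direct_power_def cong: conj_cong)
qed

lemma right_module_direct_copower: "right_module R (direct_copower M \<Lambda>)"
  using right_module.right_module_submodule[OF right_module_direct_power submodule_direct_copower]
  by (simp add: direct_copower_def)

section \<open>Zero, composition, images and kernels of homomorphisms\<close>

lemma Hom_zero:
  assumes "right_module R L" "f \<in> Hom R M L"
  shows "f \<zero>\<^bsub>M\<^esub> = \<zero>\<^bsub>L\<^esub>"
proof -
  interpret L: right_module R L by fact
  \<comment> \<open>The definition of \<open>Hom\<close> does not mention zero. Its preservation
    comes from compatibility with the scalar zero, which sends every element to zero.\<close>
  show ?thesis
    using Hom_smult[OF assms(2), of \<zero> "\<zero>\<^bsub>M\<^esub>"] Hom_closed[OF assms(2), of "\<zero>\<^bsub>M\<^esub>"]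
    by (simp add: smult_l_null L.smult_l_null)
qed

lemma Hom_compose:
  assumes "f \<in> Hom R M L" "g \<in> Hom R L K"
  shows "compose (carrier M) g f \<in> Hom R M K"
  by (rule HomI) (auto simp: compose_def assms[THEN Hom_closed] assms[THEN Hom_add]
      assms[THEN Hom_smult] assms(2)[THEN Hom_closed, OF assms(1)[THEN Hom_closed]])

lemma zero_Hom:
  assumes "right_module R L"
  shows "(\<lambda>x\<in>carrier M. \<zero>\<^bsub>L\<^esub>) \<in> Hom R M L"
proof -
  interpret L: right_module R L by fact
  show ?thesis by (rule HomI) (auto simp: L.smult_r_null)
qed

lemma submodule_Hom_image:
  assumes "right_module R L" "f \<in> Hom R M L" "submodule N R M"
  shows "submodule (f ` N) R L"
proof -
  interpret L: right_module R L by fact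
  note N = submoduleD[OF assms(3)]
  note f = assms(2)[THEN Hom_closed] assms(2)[THEN Hom_add] assms(2)[THEN Hom_smult]
  have sub: "x \<in> carrier M" if "x \<in> N" for x
    using N(1) that by blast
  show ?thesis
  proof (rule L.submoduleI)
    show "f ` N \<subseteq> carrier L"
      using f(1) sub by blast
    show "\<zero>\<^bsub>L\<^esub> \<in> f ` N"
      using N(2) Hom_zero[OF assms(1,2)] by (metis imageI)
  next
    fix y z assume "y \<in> f ` N" "z \<in> f ` N"
    then obtain u v where "u \<in> N" "v \<in> N" "y = f u" "z = f v"
      by blast
    then have "y \<oplus>\<^bsub>L\<^esub> z = f (u \<oplus>\<^bsub>M\<^esub> v)" "u \<oplus>\<^bsub>M\<^esub> v \<in> N"
      using f(2)[of u v] sub N(3) by simp_all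
    then show "y \<oplus>\<^bsub>L\<^esub> z \<in> f ` N"
      by simp
  next
    fix a y assume a: "a \<in> carrier R" and "y \<in> f ` N"
    then obtain u where "u \<in> N" "y = f u"
      by blast
    then have "a \<odot>\<^bsub>L\<^esub> y = f (a \<odot>\<^bsub>M\<^esub> u)" "a \<odot>\<^bsub>M\<^esub> u \<in> N"
      using f(3)[of a u] sub N(5) a by simp_all
    then show "a \<odot>\<^bsub>L\<^esub> y \<in> f ` N"
      by simp
  qed
qed

lemma submodule_Hom_kernel:
  assumes "right_module R L" "f \<in> Hom R M L"
  shows "submodule (a_kernel M L f) R M"
proof -
  interpret L: right_module R L by fact
  show ?thesis
    unfolding a_kernel_def'
    by (rule submoduleI) (auto simp: Hom_zero[OF assms] Hom_add[OF assms(2)]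
        Hom_smult[OF assms(2)] L.smult_r_null)
qed

subsection \<open>Direct summands and retractions\<close>

text \<open>The sum condition makes decompositions exist, the trivial intersection makes them
  unique. The kernel is recorded as well, so that exchanging \<open>D\<close> and \<open>E\<close>
  exhibits a summand as a kernel.\<close>

lemma projection_along:
  assumes D: "submodule D R M" and E: "submodule E R M"
    and DE: "D \<inter> E = {\<zero>\<^bsub>M\<^esub>}" "D <+>\<^bsub>M\<^esub> E = carrier M"
  obtains p where "p \<in> Hom R M M" "\<And>x. x \<in> carrier M \<Longrightarrow> p x \<in> D" "\<And>x. x \<in> D \<Longrightarrow> p x = x"
    "a_kernel M M p = E"
proof -
  note Dc = submoduleD[OF D] and Ec = submoduleD[OF E]
  have sub: "x \<in> carrier M" if "x \<in> D \<or> x \<in> E" for x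
    using that Dc(1) Ec(1) by blast
  have ex: "\<exists>d\<in>D. \<exists>e\<in>E. x = d \<oplus>\<^bsub>M\<^esub> e" if "x \<in> carrier M" for x
    using that DE(2) unfolding set_add_def' by blast
  have uniq: "d = d'"
    if h: "d \<in> D" "e \<in> E" "d' \<in> D" "e' \<in> E" "d \<oplus>\<^bsub>M\<^esub> e = d' \<oplus>\<^bsub>M\<^esub> e'" for d e d' e'
  proof -
    have c: "d \<in> carrier M" "e \<in> carrier M" "d' \<in> carrier M" "e' \<in> carrier M"
      using h sub by auto
    \<comment> \<open>The left side lies in \<open>D\<close> and the right side in \<open>E\<close>,
      so both vanish.\<close>
    have "d \<oplus>\<^bsub>M\<^esub> \<ominus>\<^bsub>M\<^esub> d' = e' \<oplus>\<^bsub>M\<^esub> \<ominus>\<^bsub>M\<^esub> e"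
    proof -
      have "d \<oplus>\<^bsub>M\<^esub> \<ominus>\<^bsub>M\<^esub> d' = (d \<oplus>\<^bsub>M\<^esub> e) \<oplus>\<^bsub>M\<^esub> (\<ominus>\<^bsub>M\<^esub> e \<oplus>\<^bsub>M\<^esub> \<ominus>\<^bsub>M\<^esub> d')"
        using c by (simp add: M.a_assoc M.r_neg2)
      also have "\<dots> = \<ominus>\<^bsub>M\<^esub> d' \<oplus>\<^bsub>M\<^esub> (d' \<oplus>\<^bsub>M\<^esub> (e' \<oplus>\<^bsub>M\<^esub> \<ominus>\<^bsub>M\<^esub> e))"
        using c unfolding h(5) by (simp add: M.a_ac)
      also have "\<dots> = e' \<oplus>\<^bsub>M\<^esub> \<ominus>\<^bsub>M\<^esub> e"
        using c by (simp add: M.r_neg1)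
      finally show ?thesis .
    qed
    then have "d \<oplus>\<^bsub>M\<^esub> \<ominus>\<^bsub>M\<^esub> d' \<in> D \<inter> E"
      using h(1-4) Dc(3,4) Ec(3,4) by (metis IntI)
    then have "d \<oplus>\<^bsub>M\<^esub> \<ominus>\<^bsub>M\<^esub> d' = \<zero>\<^bsub>M\<^esub>"
      using DE(1) by blast
    then show ?thesis
      using c M.minus_equality[of d "\<ominus>\<^bsub>M\<^esub> d'"] by simp
  qed
  \<comment> \<open>The description is well defined by \<open>ex\<close> and \<open>uniq\<close>;
    restricting it to the carrier gives the extensionality that \<open>Hom\<close> requires.\<close>
  define p where "p = (\<lambda>x\<in>carrier M. THE d. d \<in> D \<and> (\<exists>e\<in>E. x = d \<oplus>\<^bsub>M\<^esub> e))"
  have p: "p (d \<oplus>\<^bsub>M\<^esub> e) = d" if "d \<in> D" "e \<in> E" for d e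
  proof -
    have "(THE d'. d' \<in> D \<and> (\<exists>e'\<in>E. d \<oplus>\<^bsub>M\<^esub> e = d' \<oplus>\<^bsub>M\<^esub> e')) = d"
      using that uniq by (intro the_equality) blast+
    then show ?thesis
      using that sub by (simp add: p_def)
  qed
  show thesis
  proof (rule that[of p])
    show pD: "p x \<in> D" if "x \<in> carrier M" for x
      using ex[OF that] p by auto
    show "p x = x" if "x \<in> D" for x
      using p[OF that Ec(2)] sub that by simp
    have "p x = \<zero>\<^bsub>M\<^esub> \<longleftrightarrow> x \<in> E" if x: "x \<in> carrier M" for x
    proof -
      obtain d e where de: "d \<in> D" "e \<in> E" "x = d \<oplus>\<^bsub>M\<^esub> e"
        using ex[OF x] by blast
      show ?thesis
      proof
        assume "p x = \<zero>\<^bsub>M\<^esub>"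
        then show "x \<in> E"
          using p de sub by auto
      next
        assume "x \<in> E"
        then show "p x = \<zero>\<^bsub>M\<^esub>"
          using p[OF Dc(2), of x] x by simp
      qed
    qed
    then show "a_kernel M M p = E"
      using sub unfolding a_kernel_def' by blast
    show "p \<in> Hom R M M"
    proof (rule HomI)
      show "p x \<in> carrier M" if "x \<in> carrier M" for x
        using pD that sub by blast
      show "p (x \<oplus>\<^bsub>M\<^esub> y) = p x \<oplus>\<^bsub>M\<^esub> p y" if xy: "x \<in> carrier M" "y \<in> carrier M" for x y
      proof -
        obtain d e d' e' where de: "d \<in> D" "e \<in> E" "x = d \<oplus>\<^bsub>M\<^esub> e"
          and de': "d' \<in> D" "e' \<in> E" "y = d' \<oplus>\<^bsub>M\<^esub> e'"
          using ex xy by meson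
        have "x \<oplus>\<^bsub>M\<^esub> y = (d \<oplus>\<^bsub>M\<^esub> d') \<oplus>\<^bsub>M\<^esub> (e \<oplus>\<^bsub>M\<^esub> e')"
          using de de' sub by (simp add: M.a_ac)
        then show ?thesis
          using p de de' Dc(3) Ec(3) by simp
      qed
      show "p (a \<odot>\<^bsub>M\<^esub> x) = a \<odot>\<^bsub>M\<^esub> p x" if ax: "a \<in> carrier R" "x \<in> carrier M" for a x
      proof -
        obtain d e where de: "d \<in> D" "e \<in> E" "x = d \<oplus>\<^bsub>M\<^esub> e"
          using ex[OF ax(2)] by blast
        then have "a \<odot>\<^bsub>M\<^esub> x = a \<odot>\<^bsub>M\<^esub> d \<oplus>\<^bsub>M\<^esub> a \<odot>\<^bsub>M\<^esub> e"
          using ax(1) sub smult_r_distr by blast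
        then show ?thesis
          using p de ax(1) Dc(5) Ec(5) by simp
      qed
    qed (simp add: p_def)
  qed
qed

lemma direct_summand_retraction:
  assumes "direct_summand R M D"
  obtains p where "p \<in> Hom R M M" "\<And>x. x \<in> carrier M \<Longrightarrow> p x \<in> D" "\<And>x. x \<in> D \<Longrightarrow> p x = x"
  using assms projection_along unfolding direct_summand_def by metis

text \<open>The projection onto a complement along \<open>D\<close> has kernel \<open>D\<close>;
  this needs the complement relation to be symmetric.\<close>

lemma direct_summand_kernel:
  assumes "direct_summand R M D"
  obtains q where "q \<in> Hom R M M" "a_kernel M M q = D"
proof -
  obtain E where E: "submodule D R M" "submodule E R M" "D \<inter> E = {\<zero>\<^bsub>M\<^esub>}" "D <+>\<^bsub>M\<^esub> E = carrier M"
    using assms unfolding direct_summand_def by blast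
  have "E \<inter> D = {\<zero>\<^bsub>M\<^esub>}"
    using E(3) by blast
  moreover have "E <+>\<^bsub>M\<^esub> D = carrier M"
  proof -
    have "D \<subseteq> carrier M" "E \<subseteq> carrier M"
      using E submoduleD(1) by blast+
    then have "E <+>\<^bsub>M\<^esub> D = D <+>\<^bsub>M\<^esub> E"
      unfolding set_add_def' using M.a_comm by (fastforce simp: subset_iff)
    then show ?thesis using E(4) by simp
  qed
  ultimately show ?thesis
    using projection_along[OF E(2,1)] that by metis
qed

text \<open>The complement is the kernel of \<open>p\<close>: every x splits as p x plus x - p
  x.\<close>

lemma direct_summandI:
  assumes p: "p \<in> Hom R M M" and D: "D \<subseteq> carrier M"
    and pD: "\<And>x. x \<in> carrier M \<Longrightarrow> p x \<in> D" and fix_D: "\<And>x. x \<in> D \<Longrightarrow> p x = x"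
  shows "direct_summand R M D"
proof -
  have "D = p ` carrier M"
    using D pD fix_D by force
  then have "submodule D R M"
    using submodule_Hom_image[OF right_module_axioms p submodule_carrier] by simp
  moreover have ker: "submodule (a_kernel M M p) R M"
    by (rule submodule_Hom_kernel[OF right_module_axioms p])
  moreover have "D \<inter> a_kernel M M p = {\<zero>\<^bsub>M\<^esub>}"
    using submoduleD(2)[OF \<open>submodule D R M\<close>] submoduleD(2)[OF ker] fix_D
    by (auto simp: a_kernel_def')
  moreover have "D <+>\<^bsub>M\<^esub> a_kernel M M p = carrier M"
  proof
    show "D <+>\<^bsub>M\<^esub> a_kernel M M p \<subseteq> carrier M"
      using D by (auto simp: set_add_def' a_kernel_def')
    show "carrier M \<subseteq> D <+>\<^bsub>M\<^esub> a_kernel M M p"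
    proof
      fix x assume x: "x \<in> carrier M"
      let ?y = "\<ominus>\<^bsub>M\<^esub> p x \<oplus>\<^bsub>M\<^esub> x"
      have px: "p x \<in> D" "p x \<in> carrier M"
        using pD[OF x] D by auto
      then have "\<ominus>\<^bsub>M\<^esub> p x \<in> D"
        using submoduleD(4)[OF \<open>submodule D R M\<close>] by simp
      \<comment> \<open>As \<open>D\<close> is closed under negation, \<open>p\<close> fixes the
        negative of \<open>p x\<close>, so the two terms of \<open>p ?y\<close> cancel.\<close>
      then have "p ?y = \<zero>\<^bsub>M\<^esub>"
        using x px fix_D by (simp add: Hom_add[OF p] M.l_neg)
      then have "?y \<in> a_kernel M M p"
        using x px by (simp add: a_kernel_def')
      moreover have "x = p x \<oplus>\<^bsub>M\<^esub> ?y"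
        using x px by (simp add: M.r_neg2)
      ultimately show "x \<in> D <+>\<^bsub>M\<^esub> a_kernel M M p"
        using px unfolding set_add_def' by blast
    qed
  qed
  ultimately show ?thesis
    unfolding direct_summand_def by blast
qed

lemma direct_summand_carrier: "direct_summand R M (carrier M)"
  by (rule direct_summandI[of "\<lambda>x\<in>carrier M. x"]) (auto intro: HomI)

lemma direct_summand_zero: "direct_summand R M {\<zero>\<^bsub>M\<^esub>}"
  by (rule direct_summandI[OF zero_Hom[OF right_module_axioms]]) auto

subsection \<open>Baer modules\<close>

lemma quotient_map_Hom:
  assumes "submodule N R M"
  shows "(\<lambda>x\<in>carrier M. N +>\<^bsub>M\<^esub> x) \<in> Hom R M (quotient_module M N)"
proof -
  note N = submoduleD[OF assms]
  interpret N: abelian_subgroup N M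
    using assms M.abelian_group_axioms
    by (intro abelian_subgroupI3 additive_subgroup.intro) (auto simp: submodule_def)
  \<comment> \<open>The scalar action on cosets is a union over all representatives. Representatives
    differ by elements of \<open>N\<close>, which is stable under scalars, so the union collapses to
    one coset.\<close>
  have smult: "(\<Union>y\<in>N +>\<^bsub>M\<^esub> x. N +>\<^bsub>M\<^esub> (a \<odot>\<^bsub>M\<^esub> y)) = N +>\<^bsub>M\<^esub> (a \<odot>\<^bsub>M\<^esub> x)"
    if ax: "a \<in> carrier R" "x \<in> carrier M" for a x
  proof -
    have "N +>\<^bsub>M\<^esub> (a \<odot>\<^bsub>M\<^esub> y) = N +>\<^bsub>M\<^esub> (a \<odot>\<^bsub>M\<^esub> x)" if y: "y \<in> N +>\<^bsub>M\<^esub> x" for y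
    proof -
      obtain n where n: "n \<in> N" "y = n \<oplus>\<^bsub>M\<^esub> x"
        using y unfolding a_r_coset_def' by blast
      then have "a \<odot>\<^bsub>M\<^esub> y = a \<odot>\<^bsub>M\<^esub> n \<oplus>\<^bsub>M\<^esub> a \<odot>\<^bsub>M\<^esub> x"
        using ax N(1) by (auto intro: smult_r_distr)
      then have "a \<odot>\<^bsub>M\<^esub> y \<in> N +>\<^bsub>M\<^esub> (a \<odot>\<^bsub>M\<^esub> x)"
        using N(5)[OF ax(1) n(1)] unfolding a_r_coset_def' by blast
      then show ?thesis
        using N.a_repr_independence' ax by blast
    qed
    then show ?thesis
      using N.a_rcos_self[OF ax(2)] by blast
  qed
  show ?thesis
    by (rule HomI) (auto simp: quotient_module_def A_RCOSETS_def' N.a_rcos_sum smult)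
qed

text \<open>By the universal property of the quotient, homomorphisms from M/N to M correspond to
  endomorphisms of M vanishing on \<open>N\<close>. This removes the quotient from the definition of
  \<open>Rej_inv\<close>.\<close>

lemma Rej_inv_eq:
  assumes "submodule N R M"
  shows "Rej_inv R M N =
    {x \<in> carrier M. \<forall>f\<in>Hom R M M. N \<subseteq> a_kernel M M f \<longrightarrow> f x = \<zero>\<^bsub>M\<^esub>}"
proof -
  let ?Q = "quotient_module M N" and ?\<pi> = "\<lambda>x\<in>carrier M. N +>\<^bsub>M\<^esub> x"
  note N = submoduleD[OF assms]
  interpret N: abelian_subgroup N M
    using assms M.abelian_group_axioms
    by (intro abelian_subgroupI3 additive_subgroup.intro) (auto simp: submodule_def)
  note \<pi> = quotient_map_Hom[OF assms]
  have carrier_Q: "carrier ?Q = ?\<pi> ` carrier M"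
    by (auto simp: quotient_module_def A_RCOSETS_def')
  have "(N +>\<^bsub>M\<^esub> x \<in> Rej R ?Q M) \<longleftrightarrow> (\<forall>f\<in>Hom R M M. N \<subseteq> a_kernel M M f \<longrightarrow> f x = \<zero>\<^bsub>M\<^esub>)"
    if x: "x \<in> carrier M" for x
  proof
    assume rej: "N +>\<^bsub>M\<^esub> x \<in> Rej R ?Q M"
    show "\<forall>f\<in>Hom R M M. N \<subseteq> a_kernel M M f \<longrightarrow> f x = \<zero>\<^bsub>M\<^esub>"
    proof (intro ballI impI)
      fix f assume f: "f \<in> Hom R M M" and ker: "N \<subseteq> a_kernel M M f"
      \<comment> \<open>The map induced by \<open>f\<close> on the quotient: \<open>f\<close> is
        constant on each coset of \<open>N\<close>, so the image of a coset is a singleton and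
        \<open>the_elem\<close> returns its value.\<close>
      define h where "h = (\<lambda>X\<in>carrier ?Q. the_elem (f ` X))"
      have h: "h (?\<pi> y) = f y" if y: "y \<in> carrier M" for y
      proof -
        have f_const: "f (n \<oplus>\<^bsub>M\<^esub> y) = f y" if "n \<in> N" for n
          using that y ker N(1) by (auto simp: Hom_add[OF f] Hom_closed[OF f] a_kernel_def' subset_iff)
        have "f ` (N +>\<^bsub>M\<^esub> y) = (\<Union>n\<in>N. {f (n \<oplus>\<^bsub>M\<^esub> y)})"
          by (simp add: a_r_coset_def' image_UN)
        also have "\<dots> = (\<Union>n\<in>N. {f y})"
          by (rule SUP_cong) (simp_all add: f_const)
        also have "\<dots> = {f y}"
          using N(2) by blast
        finally have "f ` (N +>\<^bsub>M\<^esub> y) = {f y}" .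
        then show ?thesis
          using y carrier_Q by (simp add: h_def)
      qed
      have "h \<in> Hom R ?Q M"
      proof (rule HomI)
        show "h X \<in> carrier M" if "X \<in> carrier ?Q" for X
          using that h Hom_closed[OF f] unfolding carrier_Q by auto
        show "h (X \<oplus>\<^bsub>?Q\<^esub> Y) = h X \<oplus>\<^bsub>M\<^esub> h Y" if XY: "X \<in> carrier ?Q" "Y \<in> carrier ?Q" for X Y
        proof -
          obtain y z where yz: "y \<in> carrier M" "z \<in> carrier M" "X = ?\<pi> y" "Y = ?\<pi> z"
            using XY unfolding carrier_Q by blast
          then have "X \<oplus>\<^bsub>?Q\<^esub> Y = ?\<pi> (y \<oplus>\<^bsub>M\<^esub> z)"
            using Hom_add[OF \<pi>] by simp
          then show ?thesis
            using yz h[of y] h[of z] h[of "y \<oplus>\<^bsub>M\<^esub> z"] Hom_add[OF f] by simp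
        qed
        show "h (a \<odot>\<^bsub>?Q\<^esub> X) = a \<odot>\<^bsub>M\<^esub> h X" if aX: "a \<in> carrier R" "X \<in> carrier ?Q" for a X
        proof -
          obtain y where y: "y \<in> carrier M" "X = ?\<pi> y"
            using aX(2) unfolding carrier_Q by blast
          then have "a \<odot>\<^bsub>?Q\<^esub> X = ?\<pi> (a \<odot>\<^bsub>M\<^esub> y)"
            using Hom_smult[OF \<pi>] aX(1) by simp
          then show ?thesis
            using y aX(1) h[of y] h[of "a \<odot>\<^bsub>M\<^esub> y"] Hom_smult[OF f] by simp
        qed
      qed (simp add: h_def)
      then show "f x = \<zero>\<^bsub>M\<^esub>"
        using rej x h[OF x] by (auto simp: Rej_def a_kernel_def')
    qed
  next
    assume *: "\<forall>f\<in>Hom R M M. N \<subseteq> a_kernel M M f \<longrightarrow> f x = \<zero>\<^bsub>M\<^esub>"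
    have "h (?\<pi> x) = \<zero>\<^bsub>M\<^esub>" if h: "h \<in> Hom R ?Q M" for h
    proof -
      \<comment> \<open>Pulling \<open>h\<close> back along the quotient map gives an endomorphism
        that kills \<open>N\<close>, because every element of \<open>N\<close> has the same coset as
        zero.\<close>
      let ?f = "compose (carrier M) h ?\<pi>"
      have f: "?f \<in> Hom R M M"
        by (rule Hom_compose[OF \<pi> h])
      have "?f n = \<zero>\<^bsub>M\<^esub>" if "n \<in> N" for n
      proof -
        have "?\<pi> n = ?\<pi> \<zero>\<^bsub>M\<^esub>"
          using that N(1,2) N.a_rcos_const by auto
        then have "?f n = ?f \<zero>\<^bsub>M\<^esub>"
          using that N(1) by (auto simp: compose_def)
        then show ?thesis
          using Hom_zero[OF right_module_axioms f] by simp
      qed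
      then have "N \<subseteq> a_kernel M M ?f"
        using N(1) by (auto simp: a_kernel_def')
      then have "?f x = \<zero>\<^bsub>M\<^esub>"
        using * f by blast
      then show ?thesis
        using x by (simp add: compose_def)
    qed
    then show "N +>\<^bsub>M\<^esub> x \<in> Rej R ?Q M"
      using x carrier_Q by (auto simp: Rej_def a_kernel_def')
  qed
  then show ?thesis
    unfolding Rej_inv_def by blast
qed

text \<open>Nonemptiness keeps the intersection inside the carrier; an empty intersection would be
  the whole type.\<close>

lemma submodule_Inter_kernel:
  assumes "X \<subseteq> Hom R M M" "X \<noteq> {}"
  shows "submodule (\<Inter>f\<in>X. a_kernel M M f) R M"
proof -
  have K: "submodule (a_kernel M M f) R M" if "f \<in> X" for f
    using submodule_Hom_kernel[OF right_module_axioms] assms(1) that by blast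
  show ?thesis
    by (rule submoduleI)
      (use assms(2) submoduleD(1)[OF K] in blast,
       auto intro: submoduleD(2,3,5)[OF K])
qed

text \<open>Annihilating endomorphisms and common kernels form a Galois connection between
  submodules and sets of endomorphisms. \<open>Rej_inv\<close> is its closure operator, and the
  closed submodules are the intersections of kernels.\<close>

lemma Baer_iff_Rej_inv:
  "Baer R M \<longleftrightarrow> (\<forall>N. submodule N R M \<longrightarrow> direct_summand R M (Rej_inv R M N))"
proof
  assume Baer: "Baer R M"
  show "\<forall>N. submodule N R M \<longrightarrow> direct_summand R M (Rej_inv R M N)"
  proof (intro allI impI)
    fix N assume N: "submodule N R M"
    let ?X = "{f \<in> Hom R M M. N \<subseteq> a_kernel M M f}"
    \<comment> \<open>The zero map makes \<open>?X\<close> nonempty, as \<open>Baer\<close> demands,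
      and bounds the intersection by the carrier.\<close>
    have zero: "(\<lambda>x\<in>carrier M. \<zero>\<^bsub>M\<^esub>) \<in> ?X"
      using zero_Hom[OF right_module_axioms] submoduleD(1)[OF N] by (auto simp: a_kernel_def')
    then have "Rej_inv R M N = (\<Inter>f\<in>?X. a_kernel M M f)"
      unfolding Rej_inv_eq[OF N] a_kernel_def' by blast
    moreover have "direct_summand R M (\<Inter>f\<in>?X. a_kernel M M f)"
    proof -
      have "?X \<subseteq> carrier (End_ring R M)" "?X \<noteq> {}"
        using zero by (auto simp: End_ring_def)
      then show ?thesis
        using Baer unfolding Baer_def by blast
    qed
    ultimately show "direct_summand R M (Rej_inv R M N)"
      by simp
  qed
next
  assume Rej: "\<forall>N. submodule N R M \<longrightarrow> direct_summand R M (Rej_inv R M N)"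
  show "Baer R M"
    unfolding Baer_def
  proof (intro allI impI)
    fix X assume X: "X \<subseteq> carrier (End_ring R M) \<and> X \<noteq> {}"
    let ?N = "\<Inter>f\<in>X. a_kernel M M f"
    have X': "X \<subseteq> Hom R M M" "X \<noteq> {}"
      using X by (auto simp: End_ring_def)
    then have N: "submodule ?N R M"
      by (rule submodule_Inter_kernel)
    have "Rej_inv R M ?N = ?N"
    proof
      show "?N \<subseteq> Rej_inv R M ?N"
        using submoduleD(1)[OF N] unfolding Rej_inv_eq[OF N] by (auto simp: a_kernel_def')
      show "Rej_inv R M ?N \<subseteq> ?N"
      proof
        fix x assume x: "x \<in> Rej_inv R M ?N"
        show "x \<in> ?N"
        proof
          fix f assume f: "f \<in> X"
          \<comment> \<open>Each \<open>f\<close> in \<open>X\<close> vanishes on \<open>?N\<close>,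
            hence is among the endomorphisms by which \<open>Rej_inv_eq\<close> tests
            \<open>x\<close>.\<close>
          then have "?N \<subseteq> a_kernel M M f"
            by blast
          then have "f x = \<zero>\<^bsub>M\<^esub>" "x \<in> carrier M"
            using x f X' unfolding Rej_inv_eq[OF N] by blast+
          then show "x \<in> a_kernel M M f"
            by (simp add: a_kernel_def')
        qed
      qed
    qed
    then show "direct_summand R M ?N"
      using Rej N by metis
  qed
qed

section \<open>Homomorphisms into powers\<close>

lemma Baer_imp_kernels_are_summands:
  assumes "Baer R M" "\<Lambda> \<noteq> {}"
  shows "kernels_are_summands R M \<Lambda>"
  unfolding kernels_are_summands_def
proof
  fix f assume f: "f \<in> Hom R M (direct_power M \<Lambda>)"
  \<comment> \<open>The coordinate maps of \<open>f\<close>, restricted to the carrier so that they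
    are extensional endomorphisms.\<close>
  let ?X = "(\<lambda>i. \<lambda>x\<in>carrier M. f x i) ` \<Lambda>"
  have fc: "f x \<in> \<Lambda> \<rightarrow>\<^sub>E carrier M" if "x \<in> carrier M" for x
    using Hom_closed[OF f that] by (simp add: direct_power_def)
  have "(\<lambda>x\<in>carrier M. f x i) \<in> Hom R M M" if "i \<in> \<Lambda>" for i
    by (rule HomI) (use that fc in \<open>auto simp: Hom_add[OF f] Hom_smult[OF f] direct_power_def\<close>)
  then have "?X \<subseteq> carrier (End_ring R M)" "?X \<noteq> {}"
    using assms(2) by (auto simp: End_ring_def)
  then have "direct_summand R M (\<Inter>g\<in>?X. a_kernel M M g)"
    using assms(1) unfolding Baer_def by blast
  moreover have "(\<Inter>g\<in>?X. a_kernel M M g) = a_kernel M (direct_power M \<Lambda>) f"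
  proof -
    \<comment> \<open>Values of \<open>f\<close> are undefined off the index set, as is the zero
      family, so comparing coordinates in \<open>\<Lambda>\<close> suffices.\<close>
    have *: "f x = (\<lambda>i\<in>\<Lambda>. \<zero>\<^bsub>M\<^esub>) \<longleftrightarrow> (\<forall>i\<in>\<Lambda>. f x i = \<zero>\<^bsub>M\<^esub>)" if "x \<in> carrier M" for x
      using fc[OF that] by (auto simp: fun_eq_iff PiE_iff extensional_def)
    have "(\<Inter>g\<in>?X. a_kernel M M g) = {x \<in> carrier M. \<forall>i\<in>\<Lambda>. f x i = \<zero>\<^bsub>M\<^esub>}"
      using assms(2) by (auto simp: a_kernel_def')
    also have "\<dots> = {x \<in> carrier M. f x = (\<lambda>i\<in>\<Lambda>. \<zero>\<^bsub>M\<^esub>)}"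
      using * by blast
    also have "\<dots> = a_kernel M (direct_power M \<Lambda>) f"
      by (simp add: a_kernel_def' direct_power_def)
    finally show ?thesis .
  qed
  ultimately show "direct_summand R M (a_kernel M (direct_power M \<Lambda>) f)"
    by simp
qed

text \<open>With D = ker q, the preimage of \<open>D\<close> under \<open>f\<close> is the kernel of
  q f. This composite maps into the same power, so the index set does not change.\<close>

lemma kernels_are_summands_imp_preimages:
  assumes "kernels_are_summands R M \<Lambda>"
  shows "preimages_of_summands R M \<Lambda>"
  unfolding preimages_of_summands_def
proof (intro ballI allI impI)
  fix f D assume f: "f \<in> Hom R M (direct_power M \<Lambda>)" and D: "direct_summand R (direct_power M \<Lambda>) D"
  interpret P: right_module R "direct_power M \<Lambda>" by (rule right_module_direct_power)
  obtain q where q: "q \<in> Hom R (direct_power M \<Lambda>) (direct_power M \<Lambda>)"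
    "a_kernel (direct_power M \<Lambda>) (direct_power M \<Lambda>) q = D"
    using P.direct_summand_kernel[OF D] by blast
  have "{x \<in> carrier M. f x \<in> D} = a_kernel M (direct_power M \<Lambda>) (compose (carrier M) q f)"
    using Hom_closed[OF f] unfolding q(2)[symmetric] by (auto simp: a_kernel_def' compose_def)
  then show "direct_summand R M {x \<in> carrier M. f x \<in> D}"
    using assms Hom_compose[OF f q(1)] unfolding kernels_are_summands_def by simp
qed

lemma preimages_of_summands_imp_kernels:
  assumes "preimages_of_summands R M \<Lambda>"
  shows "kernels_are_summands R M \<Lambda>"
  unfolding kernels_are_summands_def
proof
  fix f assume f: "f \<in> Hom R M (direct_power M \<Lambda>)"
  interpret P: right_module R "direct_power M \<Lambda>" by (rule right_module_direct_power)
  \<comment> \<open>The kernel is the preimage of the zero submodule, which is a summand of the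
    power.\<close>
  have "direct_summand R M {x \<in> carrier M. f x \<in> {\<zero>\<^bsub>direct_power M \<Lambda>\<^esub>}}"
    using assms f P.direct_summand_zero unfolding preimages_of_summands_def by blast
  then show "direct_summand R M (a_kernel M (direct_power M \<Lambda>) f)"
    by (simp add: a_kernel_def')
qed

lemma kernels_are_summands_imp_Baer:
  assumes "\<And>\<Lambda> :: ('m \<Rightarrow> 'm) set. \<Lambda> \<noteq> {} \<Longrightarrow> kernels_are_summands R M \<Lambda>"
  shows "Baer R M"
  unfolding Baer_def
proof (intro allI impI)
  fix X assume X: "X \<subseteq> carrier (End_ring R M) \<and> X \<noteq> {}"
  then have XH: "g \<in> Hom R M M" if "g \<in> X" for g
    using that by (auto simp: End_ring_def)
  \<comment> \<open>The set \<open>X\<close> of endomorphisms serves as its own index set, which is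
    why index sets of type \<open>'m \<Rightarrow> 'm\<close> suffice; the coordinate of
    \<open>f\<close> at \<open>g\<close> is \<open>g\<close>.\<close>
  define f where "f = (\<lambda>x\<in>carrier M. \<lambda>g\<in>X. g x)"
  have "f \<in> Hom R M (direct_power M X)"
    by (rule HomI)
      (auto simp: f_def direct_power_def fun_eq_iff XH[THEN Hom_closed] XH[THEN Hom_add]
        XH[THEN Hom_smult])
  then have "direct_summand R M (a_kernel M (direct_power M X) f)"
    using assms[of X] X unfolding kernels_are_summands_def by blast
  moreover have "a_kernel M (direct_power M X) f = (\<Inter>g\<in>X. a_kernel M M g)"
    using X by (auto simp: a_kernel_def' f_def direct_power_def fun_eq_iff)
  ultimately show "direct_summand R M (\<Inter>g\<in>X. a_kernel M M g)"
    by simp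
qed

lemma preimages_of_summands_iff_kernels:
  "preimages_of_summands R M \<Lambda> \<longleftrightarrow> kernels_are_summands R M \<Lambda>"
  using preimages_of_summands_imp_kernels kernels_are_summands_imp_preimages by blast

lemma Baer_iff_kernels_are_summands:
  "Baer R M \<longleftrightarrow> (\<forall>\<Lambda> :: ('m \<Rightarrow> 'm) set. \<Lambda> \<noteq> {} \<longrightarrow> kernels_are_summands R M \<Lambda>)"
proof (intro iffI allI impI)
  show "kernels_are_summands R M \<Lambda>" if "Baer R M" "\<Lambda> \<noteq> {}" for \<Lambda> :: "('m \<Rightarrow> 'm) set"
    using that by (rule Baer_imp_kernels_are_summands)
  show "Baer R M" if "\<forall>\<Lambda> :: ('m \<Rightarrow> 'm) set. \<Lambda> \<noteq> {} \<longrightarrow> kernels_are_summands R M \<Lambda>"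
    by (rule kernels_are_summands_imp_Baer) (simp add: that)
qed

subsection \<open>Dual Baer modules\<close>

text \<open>This translates right ideals into submodules: \<open>D\<close> is e M. As an idempotent
  e fixes its image pointwise, an endomorphism f lies in e S exactly when f M is contained in e
  M.\<close>

lemma dual_Baer_iff_largest_summand:
  "dual_Baer R M \<longleftrightarrow> (\<forall>N. submodule N R M \<longrightarrow>
     (\<exists>D. direct_summand R M D \<and> D \<subseteq> N \<and>
        (\<forall>f\<in>Hom R M M. f ` carrier M \<subseteq> N \<longrightarrow> f ` carrier M \<subseteq> D)))"
    (is "_ \<longleftrightarrow> (\<forall>N. _ \<longrightarrow> (\<exists>D. ?P N D))")
proof
  assume dual: "dual_Baer R M"
  show "\<forall>N. submodule N R M \<longrightarrow> (\<exists>D. ?P N D)"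
  proof (intro allI impI)
    fix N assume N: "submodule N R M"
    note Hom_N = Hom_carrier_update[OF submoduleD(1)[OF N]]
    obtain e where "e \<in> carrier (End_ring R M)" "e = e \<otimes>\<^bsub>End_ring R M\<^esub> e"
      "Hom R M (M\<lparr>carrier := N\<rparr>) = e <#\<^bsub>End_ring R M\<^esub> carrier (End_ring R M)"
      using dual N unfolding dual_Baer_def by blast
    then have e: "e \<in> Hom R M M" "e = compose (carrier M) e e"
      and eS: "Hom R M (M\<lparr>carrier := N\<rparr>) = (\<Union>s\<in>Hom R M M. {compose (carrier M) e s})"
      by (auto simp: End_ring_def l_coset_def)
    \<comment> \<open>Idempotence puts \<open>e\<close> itself into e S, so its image lies in
      \<open>N\<close>.\<close>
    have "e \<in> Hom R M (M\<lparr>carrier := N\<rparr>)"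
      using e unfolding eS by blast
    then have eN: "e ` carrier M \<subseteq> N"
      unfolding Hom_N by blast
    have "e (e x) = e x" if "x \<in> carrier M" for x
      using fun_cong[OF e(2), of x] that by (simp add: compose_def)
    then have "direct_summand R M (e ` carrier M)"
      using Hom_closed[OF e(1)] by (intro direct_summandI[OF e(1)]) auto
    moreover have "f ` carrier M \<subseteq> e ` carrier M" if "f \<in> Hom R M M" "f ` carrier M \<subseteq> N" for f
    proof -
      have "f \<in> Hom R M (M\<lparr>carrier := N\<rparr>)"
        unfolding Hom_N using that by blast
      then obtain s where "s \<in> Hom R M M" "f = compose (carrier M) e s"
        unfolding eS by blast
      then show ?thesis
        using Hom_closed[of s R M M] by (auto simp: compose_def)
    qed
    ultimately show "\<exists>D. ?P N D"
      using eN by blast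
  qed
next
  assume largest: "\<forall>N. submodule N R M \<longrightarrow> (\<exists>D. ?P N D)"
  show "dual_Baer R M"
    unfolding dual_Baer_def
  proof (intro allI impI)
    fix N assume N: "submodule N R M"
    note Hom_N = Hom_carrier_update[OF submoduleD(1)[OF N]]
    obtain D where P: "?P N D"
      using largest N by blast
    then have D: "direct_summand R M D" "D \<subseteq> N"
      by simp_all
    have max_D: "f ` carrier M \<subseteq> D" if "f \<in> Hom R M M" "f ` carrier M \<subseteq> N" for f
      using P that by simp
    obtain e where e: "e \<in> Hom R M M" "\<And>x. x \<in> carrier M \<Longrightarrow> e x \<in> D" "\<And>x. x \<in> D \<Longrightarrow> e x = x"
      using direct_summand_retraction[OF D(1)] by blast
    \<comment> \<open>The retraction \<open>e\<close> fixes \<open>D\<close>, so composing with it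
      changes no map with values in \<open>D\<close>. Applied to \<open>e\<close> itself, this gives
      idempotence below.\<close>
    have absorb: "f = compose (carrier M) e f"
      if "f \<in> Hom R M M" "\<And>x. x \<in> carrier M \<Longrightarrow> f x \<in> D" for f
      using that(2) e(3)
      by (intro extensionalityI[OF Hom_extensional[OF that(1)] compose_extensional]) (simp add: compose_def)
    have "Hom R M (M\<lparr>carrier := N\<rparr>) = (\<Union>s\<in>Hom R M M. {compose (carrier M) e s})"
    proof
      show "Hom R M (M\<lparr>carrier := N\<rparr>) \<subseteq> (\<Union>s\<in>Hom R M M. {compose (carrier M) e s})"
      proof
        fix f assume "f \<in> Hom R M (M\<lparr>carrier := N\<rparr>)"
        then have f: "f \<in> Hom R M M" "f ` carrier M \<subseteq> N"
          unfolding Hom_N by blast+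
        then have "f = compose (carrier M) e f"
          using absorb max_D by blast
        then show "f \<in> (\<Union>s\<in>Hom R M M. {compose (carrier M) e s})"
          using f(1) by blast
      qed
      show "(\<Union>s\<in>Hom R M M. {compose (carrier M) e s}) \<subseteq> Hom R M (M\<lparr>carrier := N\<rparr>)"
      proof
        fix f assume "f \<in> (\<Union>s\<in>Hom R M M. {compose (carrier M) e s})"
        then obtain s where s: "s \<in> Hom R M M" "f = compose (carrier M) e s"
          by blast
        have "f x \<in> N" if "x \<in> carrier M" for x
          using e(2)[OF Hom_closed[OF s(1) that]] D(2) s(2) that by (auto simp: compose_def)
        then show "f \<in> Hom R M (M\<lparr>carrier := N\<rparr>)"
          unfolding Hom_N using Hom_compose[OF s(1) e(1)] s(2) by blast
      qed
    qed
    moreover have "e = compose (carrier M) e e"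
      using absorb e by blast
    ultimately show "\<exists>e\<in>carrier (End_ring R M). e = e \<otimes>\<^bsub>End_ring R M\<^esub> e \<and>
        Hom R M (M\<lparr>carrier := N\<rparr>) = e <#\<^bsub>End_ring R M\<^esub> carrier (End_ring R M)"
      using e(1) by (intro bexI[of _ e]) (auto simp: End_ring_def l_coset_def)
  qed
qed

section \<open>The trace\<close>

lemma image_subset_Tr:
  assumes N: "submodule N R M" and f: "f \<in> Hom R M M" "f ` carrier M \<subseteq> N"
  shows "f ` carrier M \<subseteq> Tr R M (M\<lparr>carrier := N\<rparr>)"
proof
  interpret N: right_module R "M\<lparr>carrier := N\<rparr>" by (rule right_module_submodule[OF N])
  fix y assume y: "y \<in> f ` carrier M"
  have "f \<in> Hom R M (M\<lparr>carrier := N\<rparr>)"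
    using f Hom_carrier_update[OF submoduleD(1)[OF N]] by blast
  \<comment> \<open>An element of one image is a one-term sum. Sums in
    \<open>sum_of_submodules\<close> are indexed by the summand submodules, so the index is the
    image itself.\<close>
  moreover have "finsum (M\<lparr>carrier := N\<rparr>) (\<lambda>_. y) {f ` carrier M} = y"
    using y f(2) N.M.finsum_insert[of "{}" "f ` carrier M" "\<lambda>_. y"] N.M.r_zero[of y] by auto
  ultimately show "y \<in> Tr R M (M\<lparr>carrier := N\<rparr>)"
    using y unfolding Tr_def sum_of_submodules_def
    by (intro CollectI exI[of _ "\<lambda>_. y"] exI[of _ "{f ` carrier M}"]) auto
qed

text \<open>Addition in the submodule is that of \<open>M\<close>, so induction on the finite set of
  summands keeps every sum in \<open>D\<close>. Together with \<open>image_subset_Tr\<close> this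
  makes the trace the least submodule containing all images inside \<open>N\<close>.\<close>

lemma Tr_subset:
  assumes N: "submodule N R M" and D: "submodule D R M"
    and images: "\<And>f. f \<in> Hom R M M \<Longrightarrow> f ` carrier M \<subseteq> N \<Longrightarrow> f ` carrier M \<subseteq> D"
  shows "Tr R M (M\<lparr>carrier := N\<rparr>) \<subseteq> D"
proof
  interpret N: right_module R "M\<lparr>carrier := N\<rparr>" by (rule right_module_submodule[OF N])
  let ?\<N> = "{f ` carrier M | f. f \<in> Hom R M (M\<lparr>carrier := N\<rparr>)}"
  have sub: "X \<subseteq> N" "X \<subseteq> D" if "X \<in> ?\<N>" for X
    using that images Hom_carrier_update[OF submoduleD(1)[OF N], of _ R M] by blast+
  have sum: "finsum (M\<lparr>carrier := N\<rparr>) g F \<in> D"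
    if "finite F" "F \<subseteq> ?\<N>" "\<forall>X\<in>F. g X \<in> X" for g F
    using that
  proof (induction F)
    case empty
    then show ?case
      using submoduleD(2)[OF D] by simp
  next
    case (insert X F)
    have gX: "g X \<in> N" "g X \<in> D"
      using insert.prems sub[of X] by auto
    have gF: "g \<in> F \<rightarrow> N"
    proof
      fix Y assume "Y \<in> F"
      then show "g Y \<in> N"
        using insert.prems sub(1)[of Y] by auto
    qed
    have "finsum (M\<lparr>carrier := N\<rparr>) g (insert X F)
        = g X \<oplus>\<^bsub>M\<^esub> finsum (M\<lparr>carrier := N\<rparr>) g F"
      using N.M.finsum_insert[OF insert.hyps(1,2), of g] gX(1) gF by simp
    then show ?case
      using insert gX(2) submoduleD(3)[OF D] by simp
  qed
  fix x assume "x \<in> Tr R M (M\<lparr>carrier := N\<rparr>)"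
  then show "x \<in> D"
    unfolding Tr_def sum_of_submodules_def using sum by auto
qed

lemma dual_Baer_iff_Tr:
  "dual_Baer R M \<longleftrightarrow> (\<forall>N. submodule N R M \<longrightarrow> direct_summand R M (Tr R M (M\<lparr>carrier := N\<rparr>)))"
  unfolding dual_Baer_iff_largest_summand
proof (rule iff_allI, rule imp_cong[OF refl])
  fix N assume N: "submodule N R M"
  let ?T = "Tr R M (M\<lparr>carrier := N\<rparr>)"
  show "(\<exists>D. direct_summand R M D \<and> D \<subseteq> N \<and>
      (\<forall>f\<in>Hom R M M. f ` carrier M \<subseteq> N \<longrightarrow> f ` carrier M \<subseteq> D)) \<longleftrightarrow> direct_summand R M ?T"
  proof
    assume "\<exists>D. direct_summand R M D \<and> D \<subseteq> N \<and>
      (\<forall>f\<in>Hom R M M. f ` carrier M \<subseteq> N \<longrightarrow> f ` carrier M \<subseteq> D)"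
    then obtain D where D: "direct_summand R M D" "D \<subseteq> N"
      and max_D: "\<And>f. f \<in> Hom R M M \<Longrightarrow> f ` carrier M \<subseteq> N \<Longrightarrow> f ` carrier M \<subseteq> D"
      by blast
    have sub: "submodule D R M"
      using D(1) unfolding direct_summand_def by blast
    obtain p where p: "p \<in> Hom R M M" "\<And>x. x \<in> carrier M \<Longrightarrow> p x \<in> D" "\<And>x. x \<in> D \<Longrightarrow> p x = x"
      using direct_summand_retraction[OF D(1)] by blast
    \<comment> \<open>\<open>D\<close> is the image of an endomorphism with values in
      \<open>N\<close>, hence part of the trace; maximality of \<open>D\<close> gives the other
      inclusion.\<close>
    have "D = p ` carrier M"
      using p(2,3) submoduleD(1)[OF sub] by force
    then have "D \<subseteq> ?T"
      using image_subset_Tr[OF N p(1)] D(2) by simp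
    moreover have "?T \<subseteq> D"
      using Tr_subset[OF N sub max_D] .
    ultimately show "direct_summand R M ?T"
      using D(1) by simp
  next
    assume "direct_summand R M ?T"
    moreover have "?T \<subseteq> N"
      using Tr_subset[OF N N] by blast
    ultimately show "\<exists>D. direct_summand R M D \<and> D \<subseteq> N \<and>
      (\<forall>f\<in>Hom R M M. f ` carrier M \<subseteq> N \<longrightarrow> f ` carrier M \<subseteq> D)"
      using image_subset_Tr[OF N] by blast
  qed
qed

section \<open>Homomorphisms out of copowers\<close>

lemma direct_copower_simps:
  "x \<in> carrier (direct_copower M \<Lambda>) \<longleftrightarrow> x \<in> \<Lambda> \<rightarrow>\<^sub>E carrier M \<and> finite {i \<in> \<Lambda>. x i \<noteq> \<zero>\<^bsub>M\<^esub>}"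
  "\<zero>\<^bsub>direct_copower M \<Lambda>\<^esub> = (\<lambda>i\<in>\<Lambda>. \<zero>\<^bsub>M\<^esub>)"
  "x \<oplus>\<^bsub>direct_copower M \<Lambda>\<^esub> y = (\<lambda>i\<in>\<Lambda>. x i \<oplus>\<^bsub>M\<^esub> y i)"
  "a \<odot>\<^bsub>direct_copower M \<Lambda>\<^esub> x = (\<lambda>i\<in>\<Lambda>. a \<odot>\<^bsub>M\<^esub> x i)"
  by (simp_all add: direct_copower_def direct_power_def)

lemma coordinate_injection_Hom:
  assumes "i \<in> \<Lambda>"
  shows "(\<lambda>m\<in>carrier M. \<lambda>j\<in>\<Lambda>. if j = i then m else \<zero>\<^bsub>M\<^esub>) \<in> Hom R M (direct_copower M \<Lambda>)"
proof (rule HomI)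
  have "{j \<in> \<Lambda>. (if j = i then m else \<zero>\<^bsub>M\<^esub>) \<noteq> \<zero>\<^bsub>M\<^esub>} \<subseteq> {i}" for m
    by auto
  then have "finite {j \<in> \<Lambda>. (if j = i then m else \<zero>\<^bsub>M\<^esub>) \<noteq> \<zero>\<^bsub>M\<^esub>}" for m
    by (rule finite_subset) simp
  then show "(\<lambda>m\<in>carrier M. \<lambda>j\<in>\<Lambda>. if j = i then m else \<zero>\<^bsub>M\<^esub>) m \<in> carrier (direct_copower M \<Lambda>)"
    if "m \<in> carrier M" for m
    using that by (auto simp: direct_copower_simps cong: conj_cong)
qed (auto simp: direct_copower_simps fun_eq_iff smult_r_null)

text \<open>The images of the coordinate injections generate the copower, because supports are
  finite.\<close>

lemma Hom_direct_copower_in_submodule: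
  assumes f: "f \<in> Hom R (direct_copower M \<Lambda>) M" and D: "submodule D R M"
    and inj: "\<And>i m. i \<in> \<Lambda> \<Longrightarrow> m \<in> carrier M \<Longrightarrow> f (\<lambda>j\<in>\<Lambda>. if j = i then m else \<zero>\<^bsub>M\<^esub>) \<in> D"
    and x: "x \<in> carrier (direct_copower M \<Lambda>)"
  shows "f x \<in> D"
proof -
  interpret C: right_module R "direct_copower M \<Lambda>" by (rule right_module_direct_copower)
  \<comment> \<open>The induction runs over a finite set containing the support rather than the
    support itself, with \<open>x\<close> arbitrary, so that the hypothesis applies once a
    coordinate has been cleared.\<close>
  have "f x \<in> D" if "finite A" "x \<in> carrier (direct_copower M \<Lambda>)" "{i \<in> \<Lambda>. x i \<noteq> \<zero>\<^bsub>M\<^esub>} \<subseteq> A" for A x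
    using that
  proof (induction A arbitrary: x)
    case empty
    then have "x = \<zero>\<^bsub>direct_copower M \<Lambda>\<^esub>"
      by (auto simp: direct_copower_simps fun_eq_iff PiE_iff extensional_def)
    then show ?case
      using C.Hom_zero[OF right_module_axioms f] submoduleD(2)[OF D] by simp
  next
    case (insert a A)
    note x = insert.prems(1)
    show ?case
    proof (cases "a \<in> \<Lambda>")
      case False
      then show ?thesis
        using insert by blast
    next
      case True
      \<comment> \<open>The element splits into its coordinate at \<open>a\<close>, handled by
        \<open>inj\<close>, and the remainder with that coordinate cleared, whose support lies in
        \<open>A\<close>.\<close>
      let ?y = "\<lambda>j\<in>\<Lambda>. if j = a then x a else \<zero>\<^bsub>M\<^esub>" and ?z = "x(a := \<zero>\<^bsub>M\<^esub>)"
      have xa: "x a \<in> carrier M"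
        using x True by (auto simp: direct_copower_simps)
      have y: "?y \<in> carrier (direct_copower M \<Lambda>)"
        using Hom_closed[OF coordinate_injection_Hom[OF True] xa] xa by simp
      have "{i \<in> \<Lambda>. ?z i \<noteq> \<zero>\<^bsub>M\<^esub>} \<subseteq> {i \<in> \<Lambda>. x i \<noteq> \<zero>\<^bsub>M\<^esub>}"
        by auto
      then have fin: "finite {i \<in> \<Lambda>. ?z i \<noteq> \<zero>\<^bsub>M\<^esub>}"
        by (rule finite_subset) (use x in \<open>simp add: direct_copower_simps(1)\<close>)
      have z: "?z \<in> carrier (direct_copower M \<Lambda>)"
        using fin x True by (auto simp: direct_copower_simps(1) PiE_iff extensional_def simp del: fun_upd_apply)
           (auto simp: fun_upd_apply split: if_splits)
      have "x = ?y \<oplus>\<^bsub>direct_copower M \<Lambda>\<^esub> ?z"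
        using x xa by (auto simp: direct_copower_simps fun_eq_iff PiE_iff extensional_def)
      then have "f x = f ?y \<oplus>\<^bsub>M\<^esub> f ?z"
        using Hom_add[OF f y z] by simp
      moreover have "f ?z \<in> D"
        using insert.prems(2) by (intro insert.IH[OF z]) auto
      ultimately show ?thesis
        using inj[OF True xa] submoduleD(3)[OF D] by simp
    qed
  qed
  then show ?thesis
    using x by (auto simp: direct_copower_simps)
qed

text \<open>For \<open>?N\<close> the image of \<open>f\<close>, the largest summand
  \<open>D\<close> inside \<open>?N\<close> is all of \<open>?N\<close>: \<open>f\<close> maps each
  coordinate copy of M into \<open>D\<close>, and these copies generate the copower.\<close>

lemma dual_Baer_imp_images_are_summands:
  assumes "dual_Baer R M"
  shows "images_are_summands R M \<Lambda>"
  unfolding images_are_summands_def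
proof
  interpret C: right_module R "direct_copower M \<Lambda>" by (rule right_module_direct_copower)
  fix f assume f: "f \<in> Hom R (direct_copower M \<Lambda>) M"
  let ?N = "f ` carrier (direct_copower M \<Lambda>)"
  have "submodule ?N R M"
    by (rule C.submodule_Hom_image[OF right_module_axioms f C.submodule_carrier])
  then obtain D where P: "direct_summand R M D \<and> D \<subseteq> ?N \<and>
      (\<forall>g\<in>Hom R M M. g ` carrier M \<subseteq> ?N \<longrightarrow> g ` carrier M \<subseteq> D)"
    using assms unfolding dual_Baer_iff_largest_summand by blast
  then have D: "direct_summand R M D" "D \<subseteq> ?N"
    by simp_all
  have max_D: "g ` carrier M \<subseteq> D" if "g \<in> Hom R M M" "g ` carrier M \<subseteq> ?N" for g
    using P that by simp
  have "f (\<lambda>j\<in>\<Lambda>. if j = i then m else \<zero>\<^bsub>M\<^esub>) \<in> D" if i: "i \<in> \<Lambda>" and m: "m \<in> carrier M" for i m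
  proof -
    \<comment> \<open>The component of \<open>f\<close> at \<open>i\<close> is an endomorphism with
      image inside \<open>?N\<close>, so maximality of \<open>D\<close> applies to it.\<close>
    let ?g = "compose (carrier M) f (\<lambda>m\<in>carrier M. \<lambda>j\<in>\<Lambda>. if j = i then m else \<zero>\<^bsub>M\<^esub>)"
    have "?g ` carrier M \<subseteq> ?N"
      using Hom_closed[OF coordinate_injection_Hom[OF i]] by (auto simp: compose_def)
    then have "?g m \<in> D"
      using max_D[OF Hom_compose[OF coordinate_injection_Hom[OF i] f]] m by blast
    then show ?thesis
      using m by (simp add: compose_def)
  qed
  moreover have "submodule D R M"
    using D(1) unfolding direct_summand_def by blast
  ultimately have "?N \<subseteq> D"
    using Hom_direct_copower_in_submodule[OF f] by blast
  then show "direct_summand R M ?N"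
    using D by (metis subset_antisym)
qed

lemma images_are_summands_imp_images_of_summands:
  assumes "images_are_summands R M \<Lambda>"
  shows "images_of_summands R M \<Lambda>"
  unfolding images_of_summands_def
proof (intro ballI allI impI)
  interpret C: right_module R "direct_copower M \<Lambda>" by (rule right_module_direct_copower)
  fix f D assume f: "f \<in> Hom R (direct_copower M \<Lambda>) M" and D: "direct_summand R (direct_copower M \<Lambda>) D"
  obtain p where p: "p \<in> Hom R (direct_copower M \<Lambda>) (direct_copower M \<Lambda>)"
    "\<And>x. x \<in> carrier (direct_copower M \<Lambda>) \<Longrightarrow> p x \<in> D" "\<And>x. x \<in> D \<Longrightarrow> p x = x"
    using C.direct_summand_retraction[OF D] by blast
  \<comment> \<open>Precomposing with a retraction onto \<open>D\<close> turns the image of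
    \<open>D\<close> into the image of the full copower, over the same index set.\<close>
  let ?g = "compose (carrier (direct_copower M \<Lambda>)) f p"
  have "D \<subseteq> carrier (direct_copower M \<Lambda>)"
    using D submoduleD(1) unfolding direct_summand_def by blast
  then have "?g ` carrier (direct_copower M \<Lambda>) = f ` D"
    using p(2,3) by (force simp: compose_def)
  then show "direct_summand R M (f ` D)"
    using assms C.Hom_compose[OF p(1) f] unfolding images_are_summands_def by metis
qed

lemma images_of_summands_imp_images_are_summands:
  assumes "images_of_summands R M \<Lambda>"
  shows "images_are_summands R M \<Lambda>"
  using assms right_module.direct_summand_carrier[OF right_module_direct_copower]
  unfolding images_of_summands_def images_are_summands_def by blast

text \<open>The universal property of the direct sum for a family of endomorphisms indexed by
  itself: \<open>f\<close> sends x to the finite sum of the g (x g).\<close>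

lemma direct_copower_sum_Hom:
  assumes "\<Lambda> \<subseteq> Hom R M M"
  obtains f where "f \<in> Hom R (direct_copower M \<Lambda>) M"
    "\<And>g m. g \<in> \<Lambda> \<Longrightarrow> m \<in> carrier M \<Longrightarrow> f (\<lambda>j\<in>\<Lambda>. if j = g then m else \<zero>\<^bsub>M\<^esub>) = g m"
proof -
  let ?C = "direct_copower M \<Lambda>"
  interpret C: right_module R ?C by (rule right_module_direct_copower)
  have H: "g \<in> Hom R M M" if "g \<in> \<Lambda>" for g
    using assms that by blast
  define supp where "supp x = {g \<in> \<Lambda>. x g \<noteq> \<zero>\<^bsub>M\<^esub>}" for x
  define f where "f = (\<lambda>x\<in>carrier ?C. finsum M (\<lambda>g. g (x g)) (supp x))"
  have xc: "x g \<in> carrier M" if "x \<in> carrier ?C" "g \<in> \<Lambda>" for x g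
    using that by (auto simp: direct_copower_simps)
  have supp: "finite (supp x)" "supp x \<subseteq> \<Lambda>" if "x \<in> carrier ?C" for x
    using that by (auto simp: supp_def direct_copower_simps)
  have pi: "(\<lambda>g. g (x g)) \<in> A \<rightarrow> carrier M" if "x \<in> carrier ?C" "A \<subseteq> \<Lambda>" for x A
  proof
    fix g assume "g \<in> A"
    then have "g \<in> \<Lambda>"
      using that(2) by blast
    then show "g (x g) \<in> carrier M"
      using Hom_closed[OF H xc[OF that(1)]] by blast
  qed
  \<comment> \<open>The support varies with \<open>x\<close>. Every g maps zero to zero, so the sum
    may run over any finite superset, and sums for different elements can share an index
    set.\<close>
  have f_eq: "f x = finsum M (\<lambda>g. g (x g)) A"
    if x: "x \<in> carrier ?C" and A: "finite A" "A \<subseteq> \<Lambda>" "supp x \<subseteq> A" for x A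
  proof -
    have "finsum M (\<lambda>g. g (x g)) (supp x) = finsum M (\<lambda>g. g (x g)) A"
      by (rule M.add.finprod_mono_neutral_cong_left[OF A(1,3)])
        (use A(2) pi[OF x A(2)] H in \<open>auto simp: supp_def Hom_zero[OF right_module_axioms H]\<close>)
    then show ?thesis
      using x by (simp add: f_def)
  qed
  show thesis
  proof (rule that[of f])
    show "f \<in> Hom R ?C M"
    proof (rule HomI)
      show "f x \<in> carrier M" if "x \<in> carrier ?C" for x
        using that supp pi by (simp add: f_def)
      show "f (x \<oplus>\<^bsub>?C\<^esub> y) = f x \<oplus>\<^bsub>M\<^esub> f y" if xy: "x \<in> carrier ?C" "y \<in> carrier ?C" for x y
      proof -
        let ?A = "supp x \<union> supp y"
        have A: "finite ?A" "?A \<subseteq> \<Lambda>"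
          using supp xy by auto
        have "f (x \<oplus>\<^bsub>?C\<^esub> y) = finsum M (\<lambda>g. g ((x \<oplus>\<^bsub>?C\<^esub> y) g)) ?A"
          by (rule f_eq[OF C.M.a_closed[OF xy] A]) (auto simp: supp_def direct_copower_simps(3))
        also have "\<dots> = finsum M (\<lambda>g. g (x g) \<oplus>\<^bsub>M\<^esub> g (y g)) ?A"
        proof (rule M.finsum_cong'[OF refl])
          show "(\<lambda>g. g (x g) \<oplus>\<^bsub>M\<^esub> g (y g)) \<in> ?A \<rightarrow> carrier M"
            using pi[OF xy(1) A(2)] pi[OF xy(2) A(2)] by (simp add: Pi_iff)
          fix g assume "g \<in> ?A"
          then have g: "g \<in> \<Lambda>"
            using A(2) by blast
          show "g ((x \<oplus>\<^bsub>?C\<^esub> y) g) = g (x g) \<oplus>\<^bsub>M\<^esub> g (y g)"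
            using Hom_add[OF H[OF g] xc[OF xy(1) g] xc[OF xy(2) g]] g
            by (simp add: direct_copower_simps(3))
        qed
        also have "\<dots> = finsum M (\<lambda>g. g (x g)) ?A \<oplus>\<^bsub>M\<^esub> finsum M (\<lambda>g. g (y g)) ?A"
          using pi A(2) xy by (intro M.finsum_addf)
        also have "\<dots> = f x \<oplus>\<^bsub>M\<^esub> f y"
          using f_eq[OF xy(1) A] f_eq[OF xy(2) A] by simp
        finally show ?thesis .
      qed
      show "f (a \<odot>\<^bsub>?C\<^esub> x) = a \<odot>\<^bsub>M\<^esub> f x" if ax: "a \<in> carrier R" "x \<in> carrier ?C" for a x
      proof -
        have sum: "finsum M (\<lambda>g. g ((a \<odot>\<^bsub>?C\<^esub> x) g)) A = a \<odot>\<^bsub>M\<^esub> finsum M (\<lambda>g. g (x g)) A"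
          if "finite A" "A \<subseteq> \<Lambda>" for A
          using that
        proof (induction A)
          case empty
          then show ?case
            using ax by (simp add: smult_r_null)
        next
          case (insert g A)
          have ax': "a \<odot>\<^bsub>?C\<^esub> x \<in> carrier ?C"
            using ax by simp
          have g: "g (x g) \<in> carrier M" "g ((a \<odot>\<^bsub>?C\<^esub> x) g) = a \<odot>\<^bsub>M\<^esub> g (x g)"
            using Hom_smult[OF H ax(1) xc[OF ax(2)], of g g] Hom_closed[OF H xc[OF ax(2)], of g g]
              insert.prems by (simp_all add: direct_copower_simps(4))
          then show ?case
            using insert ax pi[OF ax(2), of A] pi[OF ax', of A]
            by (simp add: smult_r_distr)
        qed
        have "f (a \<odot>\<^bsub>?C\<^esub> x) = finsum M (\<lambda>g. g ((a \<odot>\<^bsub>?C\<^esub> x) g)) (supp x)"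
          by (rule f_eq[OF C.smult_closed[OF ax] supp[OF ax(2)]])
            (use ax in \<open>auto simp: supp_def direct_copower_simps(4) smult_r_null\<close>)
        then show ?thesis
          using sum[OF supp[OF ax(2)]] ax(2) by (simp add: f_def)
      qed
    qed (simp add: f_def)
    show "f (\<lambda>j\<in>\<Lambda>. if j = g then m else \<zero>\<^bsub>M\<^esub>) = g m" if gm: "g \<in> \<Lambda>" "m \<in> carrier M" for g m
    proof -
      let ?x = "\<lambda>j\<in>\<Lambda>. if j = g then m else \<zero>\<^bsub>M\<^esub>"
      have x: "?x \<in> carrier ?C"
        using Hom_closed[OF coordinate_injection_Hom[OF gm(1)] gm(2)] gm(2) by simp
      \<comment> \<open>The set \<open>{g}\<close> covers the support also for m = 0, when the
        support is empty.\<close>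
      have "f ?x = finsum M (\<lambda>g. g (?x g)) {g}"
        by (rule f_eq[OF x]) (use gm in \<open>auto simp: supp_def split: if_splits\<close>)
      then show ?thesis
        using M.finsum_insert[of "{}" g "\<lambda>g. g (?x g)"] Hom_closed[OF H[OF gm(1)] gm(2)] gm by simp
    qed
  qed
qed

lemma images_are_summands_imp_dual_Baer:
  assumes "\<And>\<Lambda> :: ('m \<Rightarrow> 'm) set. \<Lambda> \<noteq> {} \<Longrightarrow> images_are_summands R M \<Lambda>"
  shows "dual_Baer R M"
  unfolding dual_Baer_iff_largest_summand
proof (intro allI impI)
  fix N assume N: "submodule N R M"
  \<comment> \<open>All endomorphisms with image in \<open>N\<close> form the index set, nonempty
    thanks to the zero map. The image of their sum map contains each of their images and stays in
    \<open>N\<close>, so it is the required largest summand.\<close>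
  let ?\<Lambda> = "{g \<in> Hom R M M. g ` carrier M \<subseteq> N}"
  obtain f where f: "f \<in> Hom R (direct_copower M ?\<Lambda>) M"
    and f_inj: "\<And>g m. g \<in> ?\<Lambda> \<Longrightarrow> m \<in> carrier M \<Longrightarrow> f (\<lambda>j\<in>?\<Lambda>. if j = g then m else \<zero>\<^bsub>M\<^esub>) = g m"
    using direct_copower_sum_Hom[of ?\<Lambda>] by blast
  let ?D = "f ` carrier (direct_copower M ?\<Lambda>)"
  have "(\<lambda>x\<in>carrier M. \<zero>\<^bsub>M\<^esub>) \<in> ?\<Lambda>"
    using zero_Hom[OF right_module_axioms] submoduleD(2)[OF N] by auto
  then have "direct_summand R M ?D"
    using assms[of ?\<Lambda>] f unfolding images_are_summands_def by blast
  moreover have "?D \<subseteq> N"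
    using Hom_direct_copower_in_submodule[OF f N] f_inj by blast
  moreover have "g ` carrier M \<subseteq> ?D" if "g \<in> ?\<Lambda>" for g
  proof
    fix y assume "y \<in> g ` carrier M"
    then obtain m where m: "m \<in> carrier M" "y = g m"
      by blast
    have "(\<lambda>j\<in>?\<Lambda>. if j = g then m else \<zero>\<^bsub>M\<^esub>) \<in> carrier (direct_copower M ?\<Lambda>)"
      using Hom_closed[OF coordinate_injection_Hom[OF that] m(1)] m(1) by simp
    then show "y \<in> ?D"
      unfolding m(2) f_inj[OF that m(1), symmetric] by (rule imageI)
  qed
  ultimately show "\<exists>D. direct_summand R M D \<and> D \<subseteq> N \<and>
      (\<forall>f\<in>Hom R M M. f ` carrier M \<subseteq> N \<longrightarrow> f ` carrier M \<subseteq> D)"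
    by blast
qed

lemma images_of_summands_iff_images:
  "images_of_summands R M \<Lambda> \<longleftrightarrow> images_are_summands R M \<Lambda>"
  using images_of_summands_imp_images_are_summands images_are_summands_imp_images_of_summands by blast

lemma dual_Baer_iff_images_are_summands:
  "dual_Baer R M \<longleftrightarrow> (\<forall>\<Lambda> :: ('m \<Rightarrow> 'm) set. \<Lambda> \<noteq> {} \<longrightarrow> images_are_summands R M \<Lambda>)"
proof (intro iffI allI impI)
  show "images_are_summands R M \<Lambda>" if "dual_Baer R M" for \<Lambda> :: "('m \<Rightarrow> 'm) set"
    using that by (rule dual_Baer_imp_images_are_summands)
  show "dual_Baer R M" if "\<forall>\<Lambda> :: ('m \<Rightarrow> 'm) set. \<Lambda> \<noteq> {} \<longrightarrow> images_are_summands R M \<Lambda>"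
    by (rule images_are_summands_imp_dual_Baer) (simp add: that)
qed

end

theorem proposition2p12:
  fixes R :: "('r, 'x) ring_scheme" and M :: "('r, 'm, 'y) module_scheme"
  assumes "right_module R M"
  shows
    "((Baer R M \<longleftrightarrow> (\<forall>\<Lambda> :: ('m \<Rightarrow> 'm) set. \<Lambda> \<noteq> {} \<longrightarrow> preimages_of_summands R M \<Lambda>)) \<and>
      (Baer R M \<longleftrightarrow> (\<forall>\<Lambda> :: ('m \<Rightarrow> 'm) set. \<Lambda> \<noteq> {} \<longrightarrow> kernels_are_summands R M \<Lambda>)) \<and>
      (Baer R M \<longleftrightarrow> (\<forall>N. submodule N R M \<longrightarrow> direct_summand R M (Rej_inv R M N))) \<and>
      (Baer R M \<longrightarrow> (\<forall>\<Lambda> :: 'i set. \<Lambda> \<noteq> {} \<longrightarrow>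
         preimages_of_summands R M \<Lambda> \<and> kernels_are_summands R M \<Lambda>)))
     \<and>
     ((dual_Baer R M \<longleftrightarrow> (\<forall>\<Lambda> :: ('m \<Rightarrow> 'm) set. \<Lambda> \<noteq> {} \<longrightarrow> images_of_summands R M \<Lambda>)) \<and>
      (dual_Baer R M \<longleftrightarrow> (\<forall>\<Lambda> :: ('m \<Rightarrow> 'm) set. \<Lambda> \<noteq> {} \<longrightarrow> images_are_summands R M \<Lambda>)) \<and>
      (dual_Baer R M \<longleftrightarrow>
         (\<forall>N. submodule N R M \<longrightarrow> direct_summand R M (Tr R M (M\<lparr>carrier := N\<rparr>)))) \<and>
      (dual_Baer R M \<longrightarrow> (\<forall>\<Lambda> :: 'i set. \<Lambda> \<noteq> {} \<longrightarrow>
         images_of_summands R M \<Lambda> \<and> images_are_summands R M \<Lambda>)))"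
proof -
  interpret right_module R M by fact
  show ?thesis
    \<comment> \<open>Conditions (b) and (c) agree for each single index set of any type, so only
      the kernel and image forms remain to be treated.\<close>
    unfolding preimages_of_summands_iff_kernels images_of_summands_iff_images
    by (intro conjI Baer_iff_kernels_are_summands Baer_iff_Rej_inv
        dual_Baer_iff_images_are_summands dual_Baer_iff_Tr)
      (simp_all add: Baer_imp_kernels_are_summands dual_Baer_imp_images_are_summands)
qed

end
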